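(* Let $\mathcal{P}=(P_1,\ldots,P_d)$ be a family of $d$ finite point sets in $\mathbb{R}^d$ that is well-separated and in weak general position. Then for every $(\alpha_1,\dots,\alpha_d)\in[|P_1|]\times\dots\times[|P_d|]$, there exists a unique $(\alpha_1,\dots,\alpha_d)$-cut.
   Context: $[n]=\{1,\dots,n\}$. Well-separated: a family $(P_1,\dots,P_d)$ of $d$ point sets in $\mathbb{R}^d$ is well-separated if for every index set $I\subset[d]$ there is a hyperplane that separates the convex hull of $\bigcup_{i\in I}P_i$ from the convex hull of $\bigcup_{i\in[d]\setminus I}P_i$ (the two hulls lie strictly on opposite sides of the hyperplane). Weak general position: any hyperplane containing one point of each of the sets $P_1,\dots,P_d$ contains no other points of $P_1\cup\dots\cup P_d$. Orientation: a hyperplane $h$ spanned by points $p_1\in P_1,\dots,p_d\in P_d$ is oriented as follows. For $q\in\mathbb{R}^d$ let $A$ be the $(d+1)\times(d+1)$ matrix whose $i$-th row is $(p_i,1)$ for $i\in[d]$ and whose last row is $(q,1)$. The point $q$ is below $h$ if $\det A<0$, above $h$ if $\det A>0$, and on $h$ if $\det A=0$. Cut: for $(\alpha_1,\dots,\alpha_d)\in[|P_1|]\times\dots\times[|P_d|]$, an $(\alpha_1,\dots,\alpha_d)$-cut is a hyperplane $h_\alpha$ such that for each $i\in[d]$, one point of $P_i$ is on $h_\alpha$ and exactly $\alpha_i-1$ points of $P_i$ are below it. *)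

theory Defs
  imports "HOL-Analysis.Analysis"
begin

text \<open>
  The finite type \<open>'n\<close> plays the role of \<open>[d]\<close>, with \<open>d = CARD('n)\<close>. It indexes both the
  coordinates of the space and the members of the family of point sets. The orientation
  defined below refers to an order of the point sets and an order of the coordinates; since it
  depends only on how these two are matched, it is the same for every enumeration of \<open>'n\<close>.
\<close>

definition hyperplane :: "(real ^ 'n) set \<Rightarrow> bool" where
  "hyperplane h \<longleftrightarrow> (\<exists>a b. a \<noteq> 0 \<and> h = {x. a \<bullet> x = b})"

definition well_separated :: "('n::finite \<Rightarrow> (real ^ 'n) set) \<Rightarrow> bool" where
  "well_separated P \<longleftrightarrow>
     (\<forall>I. \<exists>a b. a \<noteq> 0 \<and>
        (\<forall>x \<in> convex hull (\<Union>i\<in>I. P i). a \<bullet> x < b) \<and>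
        (\<forall>x \<in> convex hull (\<Union>i\<in>-I. P i). a \<bullet> x > b))"

definition weak_general_position :: "('n::finite \<Rightarrow> (real ^ 'n) set) \<Rightarrow> bool" where
  "weak_general_position P \<longleftrightarrow>
     (\<forall>h p. hyperplane h \<and> (\<forall>i. p i \<in> P i \<inter> h) \<longrightarrow> (\<Union>i. P i) \<inter> h = range p)"

text \<open>
  Row \<open>Some i\<close> is \<open>(p i, 1)\<close> and row \<open>None\<close> is \<open>(q, 1)\<close>; the column \<open>None\<close> is the column of
  ones. In both index sets \<open>None\<close> stands for \<open>d + 1\<close>.
\<close>
definition orientation_matrix ::
    "('n::finite \<Rightarrow> real ^ 'n) \<Rightarrow> real ^ 'n \<Rightarrow> real ^ 'n option ^ 'n option" where
  "orientation_matrix p q =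
     (\<chi> r c. let x = (case r of Some i \<Rightarrow> p i | None \<Rightarrow> q)
             in (case c of Some j \<Rightarrow> x $ j | None \<Rightarrow> 1))"

definition below :: "('n::finite \<Rightarrow> real ^ 'n) \<Rightarrow> real ^ 'n \<Rightarrow> bool" where
  "below p q \<longleftrightarrow> det (orientation_matrix p q) < 0"

text \<open>
  Only hyperplanes spanned by points \<open>p i \<in> P i\<close> are oriented, which is why \<open>h\<close> is required
  to be their affine hull. For well-separated \<open>P\<close> every hyperplane meeting each \<open>P i\<close> in the
  single point \<open>p i\<close> has this property, as the points \<open>p i\<close> are then affinely independent.
\<close>
definition is_cut ::
    "('n::finite \<Rightarrow> (real ^ 'n) set) \<Rightarrow> ('n \<Rightarrow> nat) \<Rightarrow> (real ^ 'n) set \<Rightarrow> bool" where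
  "is_cut P \<alpha> h \<longleftrightarrow> hyperplane h \<and>
     (\<exists>p. h = affine hull (range p) \<and>
          (\<forall>i. P i \<inter> h = {p i} \<and> card {q \<in> P i. below p q} = \<alpha> i - 1))"

end

theory Submission
  imports Defs
begin

text \<open>
  Choosing one point \<open>p i\<close> from every \<open>P i\<close> gives a \<^emph>\<open>transversal\<close>. By well-separation its points are
  affinely independent, so it spans a hyperplane, and by weak general position that hyperplane
  meets \<open>P i\<close> in \<open>p i\<close> only. Every transversal thus yields a cut for exactly one \<open>\<alpha>\<close>, and every
  cut arises in this way. There are as many transversals as admissible \<open>\<alpha>\<close>, namely
  \<open>\<Prod>i. card (P i)\<close>, so the map from transversals to \<open>\<alpha>\<close> is bijective as soon as it is
  injective: existence follows from uniqueness by counting.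

  For injectivity (\<open>below_counts_determine_transversal\<close>), let \<open>p\<close> and \<open>p'\<close> have the same counts,
  and let \<open>g\<close> and \<open>g'\<close> be the affine functions \<open>q \<mapsto> det A\<close> that orient their hyperplanes. Equal
  counts give points \<open>x i\<close> and \<open>y i\<close> in \<open>P i\<close> with \<open>g (x i) \<le> 0 \<le> g' (x i)\<close> and
  \<open>g' (y i) \<le> 0 \<le> g (y i)\<close>. Hence every function \<open>(1 - t) * g - t * g'\<close> with \<open>0 \<le> t \<le> 1\<close> is
  nonpositive at \<open>x i\<close> and nonnegative at \<open>y i\<close>, and its zero set crosses the segment from \<open>x i\<close>
  to \<open>y i\<close>. If \<open>p \<noteq> p'\<close>, this moves the oriented hyperplane of \<open>g\<close> continuously to that of \<open>- g'\<close>
  through hyperplanes that all meet the convex hull of every \<open>P i\<close>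
  (\<open>opposite_weak_signs_imp_eq\<close>).

  Along such a motion the orientation cannot flip. The side on which a normal vector \<open>n\<close> of the
  moving hyperplane points is the sign of a determinant that depends continuously on \<open>n\<close> and on
  the points chosen in the hulls, and well-separation keeps it away from zero
  (\<open>facet_normal_not_orthogonal\<close>, \<open>orientation_constant_along_path\<close>). But the normal of \<open>g\<close>
  points to the positive side for \<open>p\<close>, while that of \<open>- g'\<close> points to the negative side for
  \<open>p'\<close>, so \<open>p = p'\<close>.
\<close>

section \<open>The oriented height above a transversal hyperplane\<close>

abbreviation height :: "('n::finite \<Rightarrow> real ^ 'n) \<Rightarrow> real ^ 'n \<Rightarrow> real" where
  "height p x \<equiv> det (orientation_matrix p x)"

text \<open>
  The height is an affine function of the point, and this is its gradient, read off along the
  coordinate axes.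
\<close>
definition facet_normal :: "('n::finite \<Rightarrow> real ^ 'n) \<Rightarrow> real ^ 'n" where
  "facet_normal p = (\<chi> k. height p (axis k 1) - height p 0)"

definition homogeneous :: "real ^ 'n::finite \<Rightarrow> real ^ 'n option" where
  "homogeneous x = (\<chi> c. case c of Some j \<Rightarrow> x $ j | None \<Rightarrow> 1)"

lemma orientation_matrix_row:
  "orientation_matrix p x $ r = homogeneous (case r of Some i \<Rightarrow> p i | None \<Rightarrow> x)"
  by (simp add: orientation_matrix_def homogeneous_def vec_eq_iff Let_def)

text \<open>
  The determinant is linear in its last row, and the difference of two homogenized points has
  last coordinate zero, so that only the gradient remains.
\<close>
lemma height_diff: "height p x - height p y = facet_normal p \<bullet> (x - y)"
proof -
  define L where "L v = det (\<chi> r. if r = None then v else homogeneous (p (the r)))" for v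
  have height_L: "height p z = L (homogeneous z)" for z
    unfolding L_def
    by (rule arg_cong[where f = det])
      (auto simp: vec_eq_iff orientation_matrix_row split: option.splits)
  have "linear L"
  proof (rule linearI)
    show "L (u + v) = L u + L v" for u v
      unfolding L_def by (rule det_row_add)
    show "L (c *\<^sub>R v) = c *\<^sub>R L v" for c v
      unfolding L_def using det_row_mul[of None c "\<lambda>_. v" "\<lambda>r. homogeneous (p (the r))"]
      unfolding scalar_mult_eq_scaleR real_scaleR_def .
  qed
  have normal: "facet_normal p $ k = L (axis (Some k) 1)" for k
  proof -
    have "axis (Some k) 1 = homogeneous (axis k 1) - homogeneous 0"
      by (auto simp: vec_eq_iff homogeneous_def axis_def split: option.splits)
    then show ?thesis
      by (simp add: facet_normal_def height_L linear_diff[OF \<open>linear L\<close>])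
  qed
  have "homogeneous x - homogeneous y = (\<Sum>k\<in>UNIV. (x - y) $ k *\<^sub>R axis (Some k) 1)"
    by (auto simp: vec_eq_iff homogeneous_def axis_def if_distrib[of "\<lambda>z. _ * z"] cong: if_cong
        split: option.splits)
  then have "L (homogeneous x - homogeneous y) = (\<Sum>k\<in>UNIV. (x - y) $ k * L (axis (Some k) 1))"
    by (simp add: linear_sum[OF \<open>linear L\<close>] linear_scale[OF \<open>linear L\<close>])
  then show ?thesis
    by (simp add: height_L normal linear_diff[OF \<open>linear L\<close>] inner_vec_def mult.commute)
qed

lemma height_vertex [simp]: "height p (p i) = 0"
  by (rule det_identical_rows[of "Some i" None])
    (simp_all add: row_def orientation_matrix_row)

lemma height_eq_normal: "height p x = facet_normal p \<bullet> (x - p i)"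
  using height_diff[of p x "p i"] by simp

text \<open>
  A vanishing determinant means dependent rows; in homogeneous coordinates, a linear dependence
  is an affine one.
\<close>
lemma height_zero_dependence:
  assumes "height p x = 0"
  obtains \<kappa> \<mu> where "\<mu> \<noteq> 0 \<or> (\<exists>i. \<kappa> i \<noteq> 0)" "(\<Sum>i\<in>UNIV. \<kappa> i) + \<mu> = 0"
    "(\<Sum>i\<in>UNIV. \<kappa> i *\<^sub>R p i) + \<mu> *\<^sub>R x = 0"
proof -
  have "\<not> (\<exists>B. orientation_matrix p x ** B = mat 1)"
    using assms invertible_right_inverse invertible_det_nz by metis
  then obtain c r where c: "(\<Sum>r\<in>UNIV. c r *s row r (orientation_matrix p x)) = 0" "c r \<noteq> 0"
    unfolding matrix_right_invertible_independent_rows by blast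
  have sum0: "c None *\<^sub>R homogeneous x + (\<Sum>i\<in>UNIV. c (Some i) *\<^sub>R homogeneous (p i)) = 0"
    using c(1) by (simp add: UNIV_option_conv sum.reindex row_def orientation_matrix_row
        scalar_mult_eq_scaleR)
  show thesis
  proof
    show "c None \<noteq> 0 \<or> (\<exists>i. c (Some i) \<noteq> 0)"
      using c(2) by (cases r) auto
    show "(\<Sum>i\<in>UNIV. c (Some i)) + c None = 0"
      using arg_cong[OF sum0, of "\<lambda>v. v $ None"] by (simp add: homogeneous_def)
    show "(\<Sum>i\<in>UNIV. c (Some i) *\<^sub>R p i) + c None *\<^sub>R x = 0"
    proof (rule vec_eq_iff[THEN iffD2, rule_format])
      fix j
      show "((\<Sum>i\<in>UNIV. c (Some i) *\<^sub>R p i) + c None *\<^sub>R x) $ j = 0 $ j"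
        using arg_cong[OF sum0, of "\<lambda>v. v $ Some j"] by (simp add: homogeneous_def)
    qed
  qed
qed

lemma continuous_on_height:
  assumes "\<And>i. continuous_on S (\<lambda>t. q t i)"
  shows "continuous_on S (\<lambda>t. height (q t) x)"
proof -
  have entry: "continuous_on S (\<lambda>t. orientation_matrix (q t) x $ r $ c)" for r c
    using assms by (cases r; cases c) (auto simp: orientation_matrix_def intro!: continuous_intros)
  then show ?thesis
    unfolding det_def
    by (intro continuous_on_sum continuous_on_mult continuous_on_const continuous_on_prod entry)
qed

lemma continuous_on_facet_normal:
  assumes "\<And>i. continuous_on S (\<lambda>t. q t i)"
  shows "continuous_on S (\<lambda>t. facet_normal (q t))"
  unfolding facet_normal_def by (intro continuous_intros continuous_on_height assms)

section \<open>Transversals of a well-separated family\<close>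

text \<open>
  Let \<open>a \<bullet> x = b\<close> separate the sets with a positive coefficient from the others. Then every term
  of \<open>\<Sum>i. \<kappa> i * (a \<bullet> q i - b)\<close> with \<open>\<kappa> i \<noteq> 0\<close> is negative, while the sum is zero by the two
  assumed relations.
\<close>
lemma transversal_affinely_independent:
  assumes sep: "well_separated P"
    and q: "\<And>i. q i \<in> convex hull P i"
    and sum0: "(\<Sum>i\<in>UNIV. \<kappa> i) = 0" and comb0: "(\<Sum>i\<in>UNIV. \<kappa> i *\<^sub>R q i) = 0"
  shows "\<kappa> i = 0"
proof (rule ccontr)
  assume "\<kappa> i \<noteq> 0"
  obtain a b where
    pos: "\<And>x. x \<in> convex hull (\<Union>i\<in>{i. \<kappa> i > 0}. P i) \<Longrightarrow> a \<bullet> x < b" and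
    neg: "\<And>x. x \<in> convex hull (\<Union>i\<in>-{i. \<kappa> i > 0}. P i) \<Longrightarrow> a \<bullet> x > b"
    using sep unfolding well_separated_def by metis
  have nonpos: "\<kappa> j * (a \<bullet> q j - b) \<le> 0" and strict: "\<kappa> j \<noteq> 0 \<Longrightarrow> \<kappa> j * (a \<bullet> q j - b) < 0" for j
  proof -
    have "\<kappa> j > 0 \<Longrightarrow> a \<bullet> q j < b"
      using q[of j] hull_mono[of "P j" "\<Union>i\<in>{i. \<kappa> i > 0}. P i"] by (intro pos) blast
    moreover have "\<not> \<kappa> j > 0 \<Longrightarrow> a \<bullet> q j > b"
      using q[of j] hull_mono[of "P j" "\<Union>i\<in>-{i. \<kappa> i > 0}. P i"] by (intro neg) blast
    ultimately show "\<kappa> j * (a \<bullet> q j - b) \<le> 0" "\<kappa> j \<noteq> 0 \<Longrightarrow> \<kappa> j * (a \<bullet> q j - b) < 0"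
      by (cases "\<kappa> j > 0"; simp add: mult_le_0_iff mult_less_0_iff)+
  qed
  have "(\<Sum>j\<in>UNIV. \<kappa> j * (a \<bullet> q j - b)) < 0"
    using sum_strict_mono_ex1[of UNIV "\<lambda>j. \<kappa> j * (a \<bullet> q j - b)" "\<lambda>_. 0"]
      nonpos strict[OF \<open>\<kappa> i \<noteq> 0\<close>] by auto
  moreover have "(\<Sum>j\<in>UNIV. \<kappa> j * (a \<bullet> q j - b))
      = a \<bullet> (\<Sum>j\<in>UNIV. \<kappa> j *\<^sub>R q j) - b * (\<Sum>j\<in>UNIV. \<kappa> j)"
    by (simp add: inner_sum_right sum_distrib_left sum_subtractf algebra_simps)
  ultimately show False
    by (simp add: sum0 comb0)
qed

text \<open>A coincidence \<open>q i = q j\<close> would be the affine dependence with coefficients \<open>1\<close> and \<open>-1\<close>.\<close>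
lemma transversal_inj:
  assumes "well_separated P" "\<And>i. q i \<in> convex hull P i"
  shows "inj q"
proof (rule injI, rule ccontr)
  fix i j
  assume ij: "q i = q j" "i \<noteq> j"
  let ?l = "\<lambda>k. if k = i then 1 else if k = j then -1 else (0::real)"
  have eq: "f j = f i \<Longrightarrow> (\<Sum>k\<in>UNIV. ?l k *\<^sub>R f k) = 0" for f :: "'a \<Rightarrow> 'b::real_vector"
  proof -
    assume f: "f j = f i"
    have "(\<Sum>k\<in>UNIV. ?l k *\<^sub>R f k) = (\<Sum>k\<in>{i, j}. ?l k *\<^sub>R f k)"
      by (rule sum.mono_neutral_right) auto
    then show ?thesis
      using ij f by simp
  qed
  have "?l i = 0"
  proof (rule transversal_affinely_independent[OF assms, where \<kappa> = ?l and i = i])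
    show "(\<Sum>k\<in>UNIV. ?l k) = 0"
      using eq[of "\<lambda>_. 1::real"] by (simp only: real_scaleR_def mult_1_right)
    show "(\<Sum>k\<in>UNIV. ?l k *\<^sub>R q k) = 0"
      by (rule eq) (simp only: ij)
  qed
  then show False by simp
qed

text \<open>
  This is where well-separation prevents a change of orientation. If the product were zero, the
  point \<open>q j + n\<close> would have height zero and hence be affinely dependent on the points of \<open>q\<close>.
  Taking the inner product with \<open>n\<close>, which is constant on \<open>q\<close>, shows that \<open>q j + n\<close> itself has
  coefficient zero, so the dependence would be one among the points of \<open>q\<close>.
\<close>
lemma facet_normal_not_orthogonal:
  assumes sep: "well_separated P" and q: "\<And>i. q i \<in> convex hull P i"
    and "n \<noteq> 0" and flat: "\<And>i j. n \<bullet> q i = n \<bullet> q j"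
  shows "facet_normal q \<bullet> n \<noteq> 0"
proof
  assume "facet_normal q \<bullet> n = 0"
  fix j
  have "height q (q j + n) = 0"
    using height_eq_normal[of q "q j + n" j] \<open>facet_normal q \<bullet> n = 0\<close> by simp
  then obtain \<kappa> \<mu> where nontriv: "\<mu> \<noteq> 0 \<or> (\<exists>i. \<kappa> i \<noteq> 0)" and
    sum0: "(\<Sum>i\<in>UNIV. \<kappa> i) + \<mu> = 0" and
    comb0: "(\<Sum>i\<in>UNIV. \<kappa> i *\<^sub>R q i) + \<mu> *\<^sub>R (q j + n) = 0"
    by (rule height_zero_dependence)
  have "0 = n \<bullet> ((\<Sum>i\<in>UNIV. \<kappa> i *\<^sub>R q i) + \<mu> *\<^sub>R (q j + n))"
    by (simp only: comb0 inner_zero_right)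
  also have "\<dots> = (\<Sum>i\<in>UNIV. \<kappa> i * (n \<bullet> q i)) + \<mu> * (n \<bullet> q j) + \<mu> * (n \<bullet> n)"
    by (simp add: inner_sum_right inner_add_right algebra_simps)
  also have "(\<Sum>i\<in>UNIV. \<kappa> i * (n \<bullet> q i)) = (\<Sum>i\<in>UNIV. \<kappa> i) * (n \<bullet> q j)"
    unfolding sum_distrib_right by (intro sum.cong refl arg_cong2[of _ _ _ _ "(*)"] flat)
  also have "\<dots> + \<mu> * (n \<bullet> q j) = ((\<Sum>i\<in>UNIV. \<kappa> i) + \<mu>) * (n \<bullet> q j)"
    by (simp add: algebra_simps)
  finally have "\<mu> = 0"
    using sum0 \<open>n \<noteq> 0\<close> by simp
  with sum0 comb0 have "\<kappa> i = 0" for i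
    by - (rule transversal_affinely_independent[OF sep q, where \<kappa> = \<kappa>], simp_all)
  with nontriv \<open>\<mu> = 0\<close> show False by simp
qed

text \<open>
  As many points as the dimension always lie in some hyperplane, whose normal vector serves as
  the \<open>n\<close> of the preceding lemma.
\<close>
lemma facet_normal_nonzero:
  fixes P :: "'n::finite \<Rightarrow> (real ^ 'n) set"
  assumes sep: "well_separated P" and q: "\<And>i. q i \<in> convex hull P i"
  shows "facet_normal q \<noteq> 0"
proof -
  have "aff_dim (range q) \<le> int (card (range q)) - 1"
    by (rule aff_dim_le_card) simp
  also have "\<dots> < DIM(real ^ 'n)"
    using card_image_le[of "UNIV :: 'n set" q] by simp
  finally obtain n b where "n \<noteq> 0" "range q \<subseteq> {x. n \<bullet> x = b}"
    by (rule aff_lowdim_subset_hyperplane)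
  then have "n \<bullet> q i = b" for i by auto
  then show ?thesis
    using facet_normal_not_orthogonal[OF sep q \<open>n \<noteq> 0\<close>] by auto
qed

text \<open>
  A point of height zero has an affine dependence with the points of \<open>q\<close>. Its own coefficient
  cannot vanish, so dividing by it writes the point as an affine combination of \<open>q\<close>.
\<close>
lemma affine_hull_transversal:
  fixes P :: "'n::finite \<Rightarrow> (real ^ 'n) set"
  assumes sep: "well_separated P" and q: "\<And>i. q i \<in> convex hull P i"
  shows "affine hull (range q) = {x. height q x = 0}"
proof (rule antisym)
  fix j
  have eq: "{x. height q x = 0} = {x. facet_normal q \<bullet> x = facet_normal q \<bullet> q j}"
    using height_eq_normal[of q _ j] by (auto simp: inner_diff_right)
  show "affine hull (range q) \<subseteq> {x. height q x = 0}"
  proof (rule hull_minimal)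
    show "affine {x. height q x = 0}"
      unfolding eq by (rule affine_hyperplane)
  qed auto
  show "{x. height q x = 0} \<subseteq> affine hull (range q)"
  proof clarify
    fix x
    assume "height q x = 0"
    then obtain \<kappa> \<mu> where nontriv: "\<mu> \<noteq> 0 \<or> (\<exists>i. \<kappa> i \<noteq> 0)" and
      sum0: "(\<Sum>i\<in>UNIV. \<kappa> i) + \<mu> = 0" and
      comb0: "(\<Sum>i\<in>UNIV. \<kappa> i *\<^sub>R q i) + \<mu> *\<^sub>R x = 0"
      by (rule height_zero_dependence)
    have "\<mu> \<noteq> 0"
    proof
      assume "\<mu> = 0"
      with sum0 comb0 have "\<kappa> i = 0" for i
        by - (rule transversal_affinely_independent[OF sep q, where \<kappa> = \<kappa>], simp_all)
      with nontriv \<open>\<mu> = 0\<close> show False by simp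
    qed
    have inj: "inj q" by (rule transversal_inj[OF sep q])
    define u where "u v = - \<kappa> (inv q v) / \<mu>" for v
    have "sum u (range q) = (\<Sum>i\<in>UNIV. - \<kappa> i / \<mu>)"
      using inj by (simp add: sum.reindex u_def)
    also have "\<dots> = - (\<Sum>i\<in>UNIV. \<kappa> i) / \<mu>"
      by (simp add: sum_divide_distrib sum_negf)
    also have "\<dots> = 1"
      using sum0 \<open>\<mu> \<noteq> 0\<close> by (simp add: add_eq_0_iff2)
    finally have u1: "sum u (range q) = 1" .
    have "(\<Sum>v\<in>range q. u v *\<^sub>R v) = (\<Sum>i\<in>UNIV. (- 1 / \<mu>) *\<^sub>R (\<kappa> i *\<^sub>R q i))"
      using inj by (simp add: sum.reindex u_def)
    also have "\<dots> = (- 1 / \<mu>) *\<^sub>R (\<Sum>i\<in>UNIV. \<kappa> i *\<^sub>R q i)"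
      by (simp only: scaleR_sum_right)
    also have "\<dots> = x"
      using comb0 \<open>\<mu> \<noteq> 0\<close> by (simp add: add_eq_0_iff2)
    finally show "x \<in> affine hull (range q)"
      using u1 by (auto simp: affine_hull_finite)
  qed
qed

section \<open>Moving a transversal hyperplane preserves its orientation\<close>

text \<open>
  The sign of \<open>facet_normal q \<bullet> n\<close> tells whether \<open>n\<close> points above the hyperplane through \<open>q\<close>. It is
  continuous in \<open>q\<close> and \<open>n\<close> and never zero, so the intermediate value theorem keeps it positive.
\<close>
lemma orientation_constant_along_path:
  fixes q :: "real \<Rightarrow> 'n::finite \<Rightarrow> real ^ 'n"
  assumes sep: "well_separated P"
    and q: "\<And>t i. t \<in> {0..1} \<Longrightarrow> q t i \<in> convex hull P i"
    and n: "\<And>t. t \<in> {0..1} \<Longrightarrow> n t \<noteq> 0"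
    and flat: "\<And>t i j. t \<in> {0..1} \<Longrightarrow> n t \<bullet> q t i = n t \<bullet> q t j"
    and cont: "\<And>i. continuous_on {0..1} (\<lambda>t. q t i)" "continuous_on {0..1} n"
    and start: "facet_normal (q 0) \<bullet> n 0 > 0"
  shows "facet_normal (q 1) \<bullet> n 1 > 0"
proof (rule ccontr)
  assume "\<not> facet_normal (q 1) \<bullet> n 1 > 0"
  moreover have "continuous_on {0..1} (\<lambda>t. facet_normal (q t) \<bullet> n t)"
    by (intro continuous_intros continuous_on_facet_normal cont)
  ultimately obtain t where "t \<in> {0..1}" "facet_normal (q t) \<bullet> n t = 0"
    using IVT2'[of "\<lambda>t. facet_normal (q t) \<bullet> n t" 1 0 0] start by auto
  then show False
    using facet_normal_not_orthogonal[OF sep q n flat] by blast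
qed

text \<open>
  Two transversals of the hulls in the same hyperplane can be joined by straight segments, which
  stay both in the hyperplane and in the hulls. The orientation of a hyperplane therefore does
  not depend on the points that are used to define it.
\<close>
lemma orientation_constant_on_hyperplane:
  fixes q q' :: "'n::finite \<Rightarrow> real ^ 'n"
  assumes sep: "well_separated P"
    and q: "\<And>i. q i \<in> convex hull P i" and q': "\<And>i. q' i \<in> convex hull P i"
    and "n \<noteq> 0" and flat: "\<And>i j. n \<bullet> q i = n \<bullet> q j" "\<And>i j. n \<bullet> q' i = n \<bullet> q' j"
    and start: "facet_normal q \<bullet> n > 0"
  shows "facet_normal q' \<bullet> n > 0"
proof -
  let ?q = "\<lambda>t i. (1 - t) *\<^sub>R q i + t *\<^sub>R q' i"
  have "facet_normal (?q 1) \<bullet> n > 0"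
  proof (rule orientation_constant_along_path[OF sep, of ?q "\<lambda>_. n"])
    show "?q t i \<in> convex hull P i" if "t \<in> {0..1}" for t i
      using that q[of i] q'[of i] by (intro convexD[OF convex_convex_hull]) auto
    show "n \<bullet> ?q t i = n \<bullet> ?q t j" for t i j
      by (simp add: inner_add_right flat(1)[of i j] flat(2)[of i j])
  qed (use \<open>n \<noteq> 0\<close> start in \<open>auto intro!: continuous_intros\<close>)
  then show ?thesis by simp
qed

section \<open>Equal counts force equal transversals\<close>

text \<open>
  The function \<open>G t\<close> runs through the pencil from \<open>height p\<close> to \<open>- height p'\<close>, with gradient \<open>n t\<close>,
  and \<open>q t i\<close> is its zero on the segment from \<open>x i\<close> to \<open>y i\<close>. An index with \<open>p i = p' i\<close> is
  treated apart: there both heights may vanish at \<open>x i\<close> and \<open>y i\<close>, and the weight \<open>w t i\<close> would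
  be a quotient by zero; but \<open>p i\<close> is then a zero of all \<open>G t\<close>. At \<open>t = 0\<close> and \<open>t = 1\<close> the points
  \<open>q t\<close> need not be \<open>p\<close> and \<open>p'\<close>, but they lie in the hyperplanes of \<open>p\<close> and \<open>p'\<close>, which is
  enough to compare orientations.
\<close>
lemma opposite_weak_signs_imp_eq:
  fixes P :: "'n::finite \<Rightarrow> (real ^ 'n) set"
  assumes sep: "well_separated P"
    and p: "\<And>i. p i \<in> P i" and p': "\<And>i. p' i \<in> P i"
    and zero: "\<And>i x. x \<in> P i \<Longrightarrow> height p x = 0 \<Longrightarrow> x = p i"
    and zero': "\<And>i x. x \<in> P i \<Longrightarrow> height p' x = 0 \<Longrightarrow> x = p' i"
    and x: "\<And>i. x i \<in> P i \<and> height p (x i) \<le> 0 \<and> 0 \<le> height p' (x i)"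
    and y: "\<And>i. y i \<in> P i \<and> height p' (y i) \<le> 0 \<and> 0 \<le> height p (y i)"
  shows "p = p'"
proof (rule ccontr)
  assume "p \<noteq> p'"
  then obtain i0 where i0: "p i0 \<noteq> p' i0" by blast
  define G where "G t z = (1 - t) * height p z - t * height p' z" for t z
  define n where "n t = (1 - t) *\<^sub>R facet_normal p - t *\<^sub>R facet_normal p'" for t
  define w where "w t i = G t (x i) / (G t (x i) - G t (y i))" for t i
  define q where "q t i = (if p i = p' i then p i else x i + w t i *\<^sub>R (y i - x i))" for t i
  have hull: "z \<in> P i \<Longrightarrow> z \<in> convex hull P i" for z i
    by (rule hull_inc)
  have G_diff: "G t z - G t z' = n t \<bullet> (z - z')" for t z z'
  proof -
    have "G t z - G t z' = (1 - t) * (height p z - height p z') - t * (height p' z - height p' z')"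
      by (simp add: G_def algebra_simps)
    also have "\<dots> = n t \<bullet> (z - z')"
      by (simp only: height_diff n_def inner_diff_left inner_scaleR_left)
    finally show ?thesis .
  qed
  have G_x: "G t (x i) \<le> 0" and G_y: "0 \<le> G t (y i)" if "t \<in> {0..1}" for t i
    using that x[of i] y[of i]
    by (auto simp: G_def mult_nonneg_nonpos intro: order_trans[of _ 0])
  \<comment> \<open>Equality would make \<open>G t\<close> vanish at both \<open>x i\<close> and \<open>y i\<close>. For \<open>0 < t < 1\<close> both heights would
     then vanish at \<open>x i\<close>; at an end, one of them would vanish at both points, so \<open>x i = y i\<close>, and
     the sign conditions make the other height vanish there too. Either way \<open>p i = x i = p' i\<close>.\<close>
  have G_less: "G t (x i) < G t (y i)" if t: "t \<in> {0..1}" and i: "p i \<noteq> p' i" for t i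
  proof (rule ccontr)
    assume "\<not> G t (x i) < G t (y i)"
    then have "G t (x i) = 0" "G t (y i) = 0"
      using G_x[OF t, of i] G_y[OF t, of i] by auto
    moreover have "(1 - t) * height p (x i) \<le> 0" "(1 - t) * height p (y i) \<ge> 0"
      "t * height p' (x i) \<ge> 0" "t * height p' (y i) \<le> 0"
      using t x[of i] y[of i] by (auto simp: mult_nonneg_nonpos)
    ultimately have "(1 - t) * height p (x i) = 0" "t * height p' (x i) = 0"
      "(1 - t) * height p (y i) = 0" "t * height p' (y i) = 0"
      unfolding G_def by linarith+
    moreover have "height p z \<noteq> 0 \<or> height p' z \<noteq> 0" if "z \<in> P i" for z
      using zero[OF that] zero'[OF that] i by auto
    ultimately have "t = 0 \<or> t = 1" and
      "t = 0 \<Longrightarrow> height p (x i) = 0 \<and> height p (y i) = 0" and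
      "t = 1 \<Longrightarrow> height p' (x i) = 0 \<and> height p' (y i) = 0"
      using x[of i] by auto
    then have "x i = y i"
      using zero[of _ i] zero'[of _ i] x[of i] y[of i] by metis
    with x[of i] y[of i] have "height p (x i) = 0" "height p' (x i) = 0"
      by auto
    with zero zero' x i show False by metis
  qed
  have w: "p i \<noteq> p' i \<Longrightarrow> w t i \<in> {0..1}" and G_q: "G t (q t i) = 0" if t: "t \<in> {0..1}" for t i
  proof -
    show "w t i \<in> {0..1}" if "p i \<noteq> p' i"
      using G_x[OF t, of i] G_y[OF t, of i] G_less[OF t that]
      by (auto simp: w_def divide_simps)
    show "G t (q t i) = 0"
    proof (cases "p i = p' i")
      case True
      then show ?thesis
        using height_vertex[of p i] height_vertex[of p' i] by (simp add: G_def q_def)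
    next
      case False
      then have "G t (q t i) - G t (x i) = w t i * (G t (y i) - G t (x i))"
        by (simp add: q_def G_diff)
      also have "\<dots> = - G t (x i)"
        using G_less[OF t False] by (simp add: w_def field_simps)
      finally show ?thesis by simp
    qed
  qed
  have q_hull: "q t i \<in> convex hull P i" if t: "t \<in> {0..1}" for t i
  proof (cases "p i = p' i")
    case False
    have "(1 - w t i) *\<^sub>R x i + w t i *\<^sub>R y i \<in> convex hull P i"
      using w[OF t False] x[of i] y[of i] hull
      by (intro convexD[OF convex_convex_hull]) auto
    with False show ?thesis
      by (simp add: q_def algebra_simps)
  qed (simp add: q_def hull p')
  have q_flat: "n t \<bullet> q t i = n t \<bullet> q t j" if "t \<in> {0..1}" for t i j
    using G_diff[of t "q t i" "q t j"] G_q[OF that] by (simp add: inner_diff_right)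
  have n_nonzero: "n t \<noteq> 0" if "t \<in> {0..1}" for t
    using G_less[OF that i0] G_diff[of t "y i0" "x i0"] by auto
  have q_cont: "continuous_on {0..1} (\<lambda>t. q t i)" for i
  proof (cases "p i = p' i")
    case False
    have "G t (x i) - G t (y i) \<noteq> 0" if "t \<in> {0..1}" for t
      using G_less[OF that False] by simp
    with False show ?thesis
      unfolding q_def w_def G_def by (auto intro!: continuous_intros)
  qed (simp add: q_def)
  have p_flat: "facet_normal r \<bullet> r i = facet_normal r \<bullet> r j" for r :: "'n \<Rightarrow> real ^ 'n" and i j
    using height_eq_normal[of r "r i" j] by (simp add: inner_diff_right)
  have normals: "facet_normal p \<noteq> 0" "facet_normal p' \<noteq> 0"
    using facet_normal_nonzero[OF sep] hull p p' by metis+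
  have n0: "n 0 = facet_normal p" and n1: "n 1 = - facet_normal p'"
    by (simp_all add: n_def)
  \<comment> \<open>The orientation is carried from \<open>p\<close> to \<open>q 0\<close> within the first hyperplane, along the pencil to
     \<open>q 1\<close>, and to \<open>p'\<close> within the last hyperplane, whose normal has been reversed on the way.\<close>
  have "facet_normal p \<bullet> n 0 > 0"
    using normals by (simp add: n0)
  then have "facet_normal (q 0) \<bullet> n 0 > 0"
    using p hull q_hull q_flat[of 0] p_flat normals
    by (intro orientation_constant_on_hyperplane[OF sep, of p "q 0"]) (auto simp: n0)
  then have "facet_normal (q 1) \<bullet> n 1 > 0"
    using q_hull n_nonzero q_flat q_cont
    by (intro orientation_constant_along_path[OF sep, of q n])
      (auto simp: n_def intro!: continuous_intros)
  then have "facet_normal p' \<bullet> n 1 > 0"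
    using p' hull q_hull q_flat[of 1] p_flat[of p'] normals
    by (intro orientation_constant_on_hyperplane[OF sep, of "q 1" p']) (auto simp: n1)
  then show False
    using inner_ge_zero[of "facet_normal p'"] by (simp add: n1)
qed

lemma equal_card_imp_escape:
  assumes "finite A" "finite B" "card A = card B" "u \<notin> A"
  obtains z where "z \<in> insert u A" "z \<notin> B"
proof -
  have "\<not> insert u A \<subseteq> B"
    using card_mono[OF \<open>finite B\<close>, of "insert u A"] assms by auto
  with that show thesis by blast
qed

text \<open>
  The points of \<open>P i\<close> below \<open>p\<close>, together with \<open>p i\<close>, outnumber those below \<open>p'\<close>, so some point
  of \<open>P i\<close> is weakly below \<open>p\<close> and weakly above \<open>p'\<close>. Exchanging \<open>p\<close> and \<open>p'\<close> gives a point
  with the opposite signs.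
\<close>
lemma below_counts_determine_transversal:
  fixes P :: "'n::finite \<Rightarrow> (real ^ 'n) set"
  assumes fin: "\<And>i. finite (P i)" and sep: "well_separated P"
    and p: "\<And>i. p i \<in> P i" and p': "\<And>i. p' i \<in> P i"
    and zero: "\<And>i x. x \<in> P i \<Longrightarrow> height p x = 0 \<Longrightarrow> x = p i"
    and zero': "\<And>i x. x \<in> P i \<Longrightarrow> height p' x = 0 \<Longrightarrow> x = p' i"
    and card: "\<And>i. card {x \<in> P i. below p x} = card {x \<in> P i. below p' x}"
  shows "p = p'"
proof -
  have "\<exists>x. x \<in> P i \<and> height r x \<le> 0 \<and> 0 \<le> height r' x"
    if r: "r i \<in> P i" and counts: "card {x \<in> P i. below r x} = card {x \<in> P i. below r' x}"
    for r r' :: "'n \<Rightarrow> real ^ 'n" and i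
  proof -
    have "r i \<notin> {x \<in> P i. below r x}"
      by (simp add: below_def)
    then obtain z where "z \<in> insert (r i) {x \<in> P i. below r x}" "z \<notin> {x \<in> P i. below r' x}"
      by (rule equal_card_imp_escape[OF _ _ counts, rotated 2]) (simp_all add: fin)
    then show ?thesis
      using r by (auto simp: below_def intro!: exI[of _ z])
  qed
  note escape = this
  obtain x where "\<And>i. x i \<in> P i \<and> height p (x i) \<le> 0 \<and> 0 \<le> height p' (x i)"
    using escape[OF p card] by metis
  moreover obtain y where "\<And>i. y i \<in> P i \<and> height p' (y i) \<le> 0 \<and> 0 \<le> height p (y i)"
    using escape[OF p' card[symmetric]] by metis
  ultimately show ?thesis
    using opposite_weak_signs_imp_eq[OF sep p p' zero zero'] by blast
qed

section \<open>Cuts and transversals\<close>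

lemma transversal_hyperplane:
  assumes sep: "well_separated P" and p: "\<And>i. p i \<in> P i"
  shows "hyperplane (affine hull (range p))"
proof -
  fix j
  have p_hull: "p i \<in> convex hull P i" for i
    using p by (rule hull_inc)
  have "affine hull (range p) = {x. facet_normal p \<bullet> x = facet_normal p \<bullet> p j}"
    unfolding affine_hull_transversal[OF sep p_hull]
    using height_eq_normal[of p _ j] by (auto simp: inner_diff_right)
  then show ?thesis
    unfolding hyperplane_def using facet_normal_nonzero[OF sep p_hull] by blast
qed

text \<open>
  Weak general position leaves only the points \<open>p j\<close> on the hyperplane, so it remains to see that
  \<open>p j\<close> is not in \<open>P i\<close> for \<open>j \<noteq> i\<close>. Otherwise replacing \<open>p i\<close> by \<open>p j\<close> would give a transversal
  with a repeated point.
\<close>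
lemma transversal_meets_once:
  assumes sep: "well_separated P" and wgp: "weak_general_position P" and p: "\<And>i. p i \<in> P i"
  shows "P i \<inter> affine hull (range p) = {p i}"
proof -
  let ?h = "affine hull (range p)"
  have on: "p i \<in> P i \<inter> ?h" for i
    using p by (auto intro: hull_inc)
  then have range: "(\<Union>i. P i) \<inter> ?h = range p"
    using wgp transversal_hyperplane[OF sep p] unfolding weak_general_position_def by blast
  have same: "j = i" if "p j \<in> P i" for j
  proof (rule ccontr)
    assume "j \<noteq> i"
    have "inj (p(i := p j))"
      using p that by (intro transversal_inj[OF sep]) (auto intro: hull_inc)
    then show False
      using \<open>j \<noteq> i\<close> by (auto dest: injD[where x = i and y = j])
  qed
  have "x = p i" if x: "x \<in> P i" "x \<in> ?h" for x
  proof -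
    have "x \<in> (\<Union>i. P i) \<inter> ?h"
      using x by auto
    then obtain j where "x = p j"
      unfolding range by blast
    with same[of j] x(1) show ?thesis by simp
  qed
  then show ?thesis
    using on[of i] by auto
qed

theorem theorem3:
  fixes P :: "'n::finite \<Rightarrow> (real ^ 'n) set" and \<alpha> :: "'n \<Rightarrow> nat"
  assumes "\<And>i. finite (P i)"
    and "well_separated P"
    and "weak_general_position P"
    and "\<And>i. \<alpha> i \<in> {1..card (P i)}"
  shows "\<exists>!h. is_cut P \<alpha> h"
proof -
  note fin = assms(1) and sep = assms(2) and wgp = assms(3)
  define \<Phi> where "\<Phi> p = (\<lambda>i. Suc (card {x \<in> P i. below p x}))" for p
  let ?T = "PiE UNIV P"
  let ?C = "PiE UNIV (\<lambda>i. {1..card (P i)})"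
  have zero: "x = p i" if "p \<in> ?T" "x \<in> P i" "height p x = 0" for p x i
  proof -
    have p: "p j \<in> P j" for j using that(1) by auto
    then have "p j \<in> convex hull P j" for j by (rule hull_inc)
    then have "x \<in> affine hull (range p)"
      using affine_hull_transversal[OF sep] that(3) by blast
    then show ?thesis
      using transversal_meets_once[OF sep wgp p] that(2) by blast
  qed
  have inj: "inj_on \<Phi> ?T"
  proof (rule inj_onI)
    fix p p'
    assume T: "p \<in> ?T" "p' \<in> ?T" and eq: "\<Phi> p = \<Phi> p'"
    have p: "p i \<in> P i" "p' i \<in> P i" for i
      using T by auto
    have counts: "card {x \<in> P i. below p x} = card {x \<in> P i. below p' x}" for i
      using fun_cong[OF eq, of i] by (simp add: \<Phi>_def)
    show "p = p'"
      by (rule below_counts_determine_transversal[OF fin sep p])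
        (fact zero[OF T(1)] zero[OF T(2)] counts)+
  qed
  \<comment> \<open>As \<open>p i\<close> is not below its own hyperplane, at most \<open>card (P i) - 1\<close> points of \<open>P i\<close> are.\<close>
  have "\<Phi> ` ?T \<subseteq> ?C"
  proof (rule image_subsetI)
    fix p
    assume p: "p \<in> ?T"
    have "card {x \<in> P i. below p x} < card (P i)" for i
    proof (rule psubset_card_mono[OF fin])
      have "p i \<in> P i" "\<not> below p (p i)"
        using p by (auto simp: below_def)
      then show "{x \<in> P i. below p x} \<subset> P i" by blast
    qed
    then show "\<Phi> p \<in> ?C" by (auto simp: \<Phi>_def Suc_le_eq)
  qed
  \<comment> \<open>Both sides are \<open>\<Prod>i. card (P i)\<close>; with injectivity this gives every \<open>\<alpha>\<close> its transversal.\<close>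
  moreover have "card (\<Phi> ` ?T) = card ?C"
    by (simp add: card_image[OF inj] card_PiE)
  ultimately have surj: "\<Phi> ` ?T = ?C"
    by (intro card_subset_eq) (auto intro: finite_PiE)
  have cut: "is_cut P \<alpha> h \<longleftrightarrow> (\<exists>p\<in>?T. \<Phi> p = \<alpha> \<and> h = affine hull (range p))" for h
  proof
    assume "is_cut P \<alpha> h"
    then obtain p where h: "h = affine hull (range p)"
      and p: "\<And>i. P i \<inter> h = {p i} \<and> card {q \<in> P i. below p q} = \<alpha> i - 1"
      unfolding is_cut_def by blast
    have "p \<in> ?T" using p by blast
    moreover have "\<Phi> p i = \<alpha> i" for i
      using p[of i] assms(4)[of i] by (simp add: \<Phi>_def)
    ultimately show "\<exists>p\<in>?T. \<Phi> p = \<alpha> \<and> h = affine hull (range p)"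
      using h by blast
  next
    assume "\<exists>p\<in>?T. \<Phi> p = \<alpha> \<and> h = affine hull (range p)"
    then obtain p where p: "\<And>i. p i \<in> P i" and \<alpha>: "\<alpha> = \<Phi> p" and h: "h = affine hull (range p)"
      by auto
    show "is_cut P \<alpha> h"
      unfolding is_cut_def h \<alpha>
      using transversal_hyperplane[OF sep p] transversal_meets_once[OF sep wgp p]
      by (auto simp: \<Phi>_def)
  qed
  have "\<alpha> \<in> \<Phi> ` ?T"
    unfolding surj using assms(4) by auto
  then obtain p where p: "p \<in> ?T" "\<Phi> p = \<alpha>" by blast
  moreover have "p' = p" if "p' \<in> ?T" "\<Phi> p' = \<alpha>" for p'
    using inj_onD[OF inj, of p' p] that p by simp
  ultimately show ?thesis
    unfolding cut by blast
qed

end
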